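(* Let $K$ be a field of characteristic zero. If $f=f(x,y)$, $\beta=\beta(x,y)$, $\gamma=\gamma(x,y)$, $u=u(x,y)$ and $v=v(x,y)$ are formal power series in $K\{\{a,b,\dots,||x,y\}\}$, in two noncommutative variables $x$ and $y$, then $$\frac{\partial\big(f(u,v)\big)}{\partial_{\beta}x}=\frac{\partial\big(f(u,v)\big)}{\partial_{\frac{\partial u}{\partial_\beta x}}u}+\frac{\partial\big(f(u,v)\big)}{\partial_{\frac{\partial v}{\partial_\beta x}}v}$$ and $$\frac{\partial^2 f}{\partial_\gamma y\,\partial_\beta x}-\frac{\partial^2 f}{\partial_\beta x\,\partial_\gamma y}=\frac{\partial f}{\partial_{\big(\frac{\partial\beta}{\partial_\gamma y}\big)}x}-\frac{\partial f}{\partial_{\big(\frac{\partial\gamma}{\partial_\beta x}\big)}y}.$$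
   Context: $K$ is a field of characteristic zero. The alphabet consists of two distinguished letters $x,y$ (noncommuting variables) and an infinite supply of other letters $a,b,\dots$ (constants). $K\{\{a,b,\dots,||x,y\}\}$ is the algebra of noncommutative formal power series over $K$, i.e. formal $K$-linear combinations, possibly infinite, of words in this alphabet, multiplied by extending concatenation of words. Partial point-derivatives. For $\beta\in K\{\{a,b,\dots,||x,y\}\}$, the partial $\beta$-derivative with respect to $x$, $f\mapsto\frac{\partial f}{\partial_\beta x}$, is obtained by treating $y$ as a constant letter: on a word $w$, $\frac{\partial w}{\partial_\beta x}$ is the sum, over all occurrences of $x$ in $w$, of the series obtained by replacing that occurrence by $\beta$ (and it is $0$ if $x$ does not occur in $w$); it is extended linearly and continuously to all formal power series. It is a $K$-linear derivation killing all constants and $y$ and sending $x$ to $\beta$. Similarly, the partial $\beta$-derivative with respect to $y$, $\frac{\partial f}{\partial_\beta y}$, is obtained by treating $x$ as a constant letter and replacing, in turn, each occurrence of $y$ by $\beta$. The subscript may be any formal power series in $K\{\{a,b,\dots,||x,y\}\}$. Second partial derivatives are defined by $$\frac{\partial^2 f}{\partial_\gamma y\,\partial_\beta x}:=\frac{\partial}{\partial_\gamma y}\left(\frac{\partial f}{\partial_\beta x}\right),\qquad \frac{\partial^2 f}{\partial_\beta x\,\partial_\gamma y}:=\frac{\partial}{\partial_\beta x}\left(\frac{\partial f}{\partial_\gamma y}\right).$$ Substitution notation. $f(u,v)$ denotes the result of substituting $u$ for $x$ and $v$ for $y$ in $f(x,y)$, constants being unchanged. For a series $\delta$, $\frac{\partial(f(u,v))}{\partial_\delta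 u}$ denotes the partial $\delta$-derivative of $f(u,v)$ with respect to its first argument, $u$ being treated as the variable and $v$ as a constant: writing $f=\sum_w c_w w$ over words $w$, it is $\sum_w c_w A_w$, where $A_w$ is the sum, over all occurrences of $x$ in $w$, of the product obtained from $w$ by replacing that occurrence of $x$ by $\delta$, all other occurrences of $x$ by $u$, and all occurrences of $y$ by $v$. Likewise $\frac{\partial(f(u,v))}{\partial_\delta v}$ is the partial $\delta$-derivative with respect to the second argument, $\sum_w c_w B_w$, where $B_w$ is the sum, over all occurrences of $y$ in $w$, of the product obtained by replacing that occurrence of $y$ by $\delta$, all other occurrences of $y$ by $v$, and all occurrences of $x$ by $u$.
   Formalization: The first identity is stated for those f, u, v for which f(u,v) exists, i.e. each of its coefficients is a finite sum (it is undefined e.g. for f = Σ xⁿ, u = 1); existence of the right-hand sums is then part of the claim. The second identity is unconditional. *)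

theory Defs
  imports Complex_Main "HOL-Library.Groups_Big_Fun" "HOL-Library.Infinite_Typeclass"
begin

section \<open>Noncommutative formal power series\<close>

text \<open>A series over the alphabet \<^typ>\<open>'a\<close> is an arbitrary family of coefficients indexed by words.
  As the alphabet may be infinite, even the homogeneous parts of a series may be infinite sums.\<close>

typedef ('a, 'k) ncfps = "UNIV :: ('a list \<Rightarrow> 'k) set"
  morphisms coeff Abs_ncfps ..

setup_lifting type_definition_ncfps

lemma ncfps_eqI: "(\<And>w. coeff f w = coeff g w) \<Longrightarrow> f = g"
  by transfer auto

definition splits :: "'a list \<Rightarrow> ('a list \<times> 'a list) set" where
  "splits w = {(p, q). p @ q = w}"

lemma splits_alt: "splits w = (\<lambda>i. (take i w, drop i w)) ` {..length w}"
proof (rule set_eqI, clarify)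
  fix p q
  have "(p, q) = (take (length p) w, drop (length p) w) \<and> length p \<le> length w" if "p @ q = w"
    using that by auto
  then show "(p, q) \<in> splits w \<longleftrightarrow> (p, q) \<in> (\<lambda>i. (take i w, drop i w)) ` {..length w}"
    unfolding splits_def by (auto intro!: image_eqI[of _ _ "length p"])
qed

lemma finite_splits [simp]: "finite (splits w)"
  by (simp add: splits_alt)

instantiation ncfps :: (type, ring_1) ring_1
begin

lift_definition zero_ncfps :: "('a, 'b) ncfps" is "\<lambda>_. 0" .
lift_definition one_ncfps :: "('a, 'b) ncfps" is "\<lambda>w. if w = [] then 1 else 0" .
lift_definition plus_ncfps :: "('a, 'b) ncfps \<Rightarrow> ('a, 'b) ncfps \<Rightarrow> ('a, 'b) ncfps"
  is "\<lambda>f g w. f w + g w" .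
lift_definition minus_ncfps :: "('a, 'b) ncfps \<Rightarrow> ('a, 'b) ncfps \<Rightarrow> ('a, 'b) ncfps"
  is "\<lambda>f g w. f w - g w" .
lift_definition uminus_ncfps :: "('a, 'b) ncfps \<Rightarrow> ('a, 'b) ncfps"
  is "\<lambda>f w. - f w" .
lift_definition times_ncfps :: "('a, 'b) ncfps \<Rightarrow> ('a, 'b) ncfps \<Rightarrow> ('a, 'b) ncfps"
  is "\<lambda>f g w. \<Sum>(p, q)\<in>splits w. f p * g q" .

instance
proof
  fix f g h :: "('a, 'b) ncfps"
  show "f * g * h = f * (g * h)"
  proof (transfer, rule ext)
    fix f g h :: "'a list \<Rightarrow> 'b" and w
    have "(\<Sum>(p, q)\<in>splits w. (\<Sum>(p, q)\<in>splits p. f p * g q) * h q) =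
      (\<Sum>(s, t)\<in>Sigma (splits w) (\<lambda>s. splits (fst s)). f (fst t) * g (snd t) * h (snd s))"
      by (subst sum.Sigma[symmetric]) (auto simp: sum_distrib_right case_prod_unfold)
    also have "\<dots> = (\<Sum>(s, t)\<in>Sigma (splits w) (\<lambda>s. splits (snd s)). f (fst s) * (g (fst t) * h (snd t)))"
      by (rule sum.reindex_bij_witness[where
            i = "\<lambda>((p, _), (q, r)). ((p @ q, r), (p, q))" and
            j = "\<lambda>((_, r), (p, q)). ((p, q @ r), (q, r))"])
         (auto simp: splits_def mult.assoc)
    also have "\<dots> = (\<Sum>(p, q)\<in>splits w. f p * (\<Sum>(p, q)\<in>splits q. g p * h q))"
      by (subst sum.Sigma[symmetric]) (auto simp: sum_distrib_left case_prod_unfold)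
    finally show "(\<Sum>(p, q)\<in>splits w. (\<Sum>(p, q)\<in>splits p. f p * g q) * h q) =
      (\<Sum>(p, q)\<in>splits w. f p * (\<Sum>(p, q)\<in>splits q. g p * h q))" .
  qed
  show "1 * f = f"
  proof (transfer, rule ext)
    fix f :: "'a list \<Rightarrow> 'b" and w
    have "(\<Sum>(p, q)\<in>splits w. (if p = [] then 1 else 0) * f q) = (\<Sum>s\<in>{([] :: 'a list, w)}. f (snd s))"
      by (rule sum.mono_neutral_cong_right[OF finite_splits]) (auto simp: splits_def split: if_splits)
    then show "(\<Sum>(p, q)\<in>splits w. (if p = [] then 1 else 0) * f q) = f w" by simp
  qed
  show "f * 1 = f"
  proof (transfer, rule ext)
    fix f :: "'a list \<Rightarrow> 'b" and w
    have "(\<Sum>(p, q)\<in>splits w. f p * (if q = [] then 1 else 0)) = (\<Sum>s\<in>{(w, [] :: 'a list)}. f (fst s))"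
      by (rule sum.mono_neutral_cong_right[OF finite_splits]) (auto simp: splits_def split: if_splits)
    then show "(\<Sum>(p, q)\<in>splits w. f p * (if q = [] then 1 else 0)) = f w" by simp
  qed
  show "(f + g) * h = f * h + g * h"
    by transfer (auto simp: algebra_simps sum.distrib case_prod_unfold)
  show "f * (g + h) = f * g + f * h"
    by transfer (auto simp: algebra_simps sum.distrib case_prod_unfold)
  show "(0::('a, 'b) ncfps) \<noteq> 1"
    by transfer (metis zero_neq_one)
qed (transfer; auto simp: algebra_simps)+

end

lemma coeff_simps:
  "coeff 0 w = 0"
  "coeff 1 w = (if w = [] then 1 else 0)"
  "coeff (f + g) w = coeff f w + coeff g w"
  "coeff (f - g) w = coeff f w - coeff g w"
  "coeff (- f) w = - coeff f w"
  "coeff (f * g) w = (\<Sum>(p, q)\<in>splits w. coeff f p * coeff g q)"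
  by (transfer; simp)+

lemma coeff_sum: "coeff (sum F I) w = (\<Sum>i\<in>I. coeff (F i) w)"
  by (induction I rule: infinite_finite_induct) (auto simp: coeff_simps)

lift_definition single :: "'a \<Rightarrow> ('a, 'k::ring_1) ncfps"
  is "\<lambda>c w. if w = [c] then 1 else 0" .


section \<open>Infinite linear combinations\<close>

text \<open>For a series \<open>f = (\<Sum>w. c\<^sub>w w)\<close> and series \<open>A w\<close> indexed by the words, \<open>lincomb f A\<close> is
  \<open>\<Sum>w. c\<^sub>w A w\<close>. The sum is meaningful iff it is pointwise finite, which is
  \<open>lincomb_defined f A\<close>; coefficients at which it is not finite get the dummy value 0
  from \<^const>\<open>Sum_any\<close>.\<close>

definition lincomb_defined :: "('a, 'k::ring_1) ncfps \<Rightarrow> ('a list \<Rightarrow> ('a, 'k) ncfps) \<Rightarrow> bool" where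
  "lincomb_defined f A \<longleftrightarrow> (\<forall>z. finite {w. coeff f w * coeff (A w) z \<noteq> 0})"

definition lincomb :: "('a, 'k::ring_1) ncfps \<Rightarrow> ('a list \<Rightarrow> ('a, 'k) ncfps) \<Rightarrow> ('a, 'k) ncfps" where
  "lincomb f A = Abs_ncfps (\<lambda>z. Sum_any (\<lambda>w. coeff f w * coeff (A w) z))"

lemma coeff_lincomb: "coeff (lincomb f A) z = Sum_any (\<lambda>w. coeff f w * coeff (A w) z)"
  by (simp add: lincomb_def Abs_ncfps_inverse)


section \<open>Point-derivatives and substitution\<close>

datatype 'c letter = X | Y | Const 'c

type_synonym ('c, 'k) series = "('c letter, 'k) ncfps"

text \<open>The sum, over all occurrences of the letter \<open>l\<close> in \<open>w\<close>, of the product obtained from \<open>w\<close> by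
  replacing that occurrence by \<open>\<delta>\<close> and every other letter \<open>c\<close> by \<open>\<phi> c\<close>.\<close>

definition replace_occs ::
    "('a \<Rightarrow> ('a, 'k::ring_1) ncfps) \<Rightarrow> 'a \<Rightarrow> ('a, 'k) ncfps \<Rightarrow> 'a list \<Rightarrow> ('a, 'k) ncfps" where
  "replace_occs \<phi> l \<delta> w = (\<Sum>i | i < length w \<and> w ! i = l. prod_list ((map \<phi> w)[i := \<delta>]))"

text \<open>\<open>point_deriv l \<beta> f\<close> is the partial \<open>\<beta>\<close>-derivative of \<open>f\<close> with respect to the letter \<open>l\<close>,
  all other letters being treated as constants. The sum exists for all \<open>f\<close> and \<open>\<beta>\<close>, also when \<open>\<beta>\<close>
  has a constant term (lemma \<open>point_deriv_defined\<close> below).\<close>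

definition point_deriv :: "'c letter \<Rightarrow> ('c, 'k::ring_1) series \<Rightarrow> ('c, 'k) series \<Rightarrow> ('c, 'k) series" where
  "point_deriv l \<beta> f = lincomb f (replace_occs single l \<beta>)"

fun subst_letter :: "('c, 'k::ring_1) series \<Rightarrow> ('c, 'k) series \<Rightarrow> 'c letter \<Rightarrow> ('c, 'k) series" where
  "subst_letter u v X = u"
| "subst_letter u v Y = v"
| "subst_letter u v (Const c) = single (Const c)"

definition subst_word :: "('c, 'k::ring_1) series \<Rightarrow> ('c, 'k) series \<Rightarrow> 'c letter list \<Rightarrow> ('c, 'k) series" where
  "subst_word u v w = prod_list (map (subst_letter u v) w)"

text \<open>\<open>f(u, v)\<close>. It always exists if \<open>u\<close> and \<open>v\<close> have no constant term (lemma
  \<open>subst_definedI\<close> below), but for example not for \<open>f = (\<Sum>n. x\<^sup>n)\<close> and \<open>u = 1\<close>.\<close>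

definition subst_defined :: "('c, 'k::ring_1) series \<Rightarrow> ('c, 'k) series \<Rightarrow> ('c, 'k) series \<Rightarrow> bool" where
  "subst_defined f u v \<longleftrightarrow> lincomb_defined f (subst_word u v)"

definition subst :: "('c, 'k::ring_1) series \<Rightarrow> ('c, 'k) series \<Rightarrow> ('c, 'k) series \<Rightarrow> ('c, 'k) series" where
  "subst f u v = lincomb f (subst_word u v)"

text \<open>The partial \<open>\<delta>\<close>-derivative of \<open>f(u, v)\<close> with respect to its first argument \<open>u\<close> (for \<open>l = X\<close>)
  or its second argument \<open>v\<close> (for \<open>l = Y\<close>). It depends on \<open>f\<close>, \<open>u\<close>, \<open>v\<close> and not just
  on the series \<open>subst f u v\<close>.\<close>

definition arg_deriv_defined ::
    "'c letter \<Rightarrow> ('c, 'k::ring_1) series \<Rightarrow> ('c, 'k) series \<Rightarrow> ('c, 'k) series \<Rightarrow> ('c, 'k) series \<Rightarrow> bool" where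
  "arg_deriv_defined l \<delta> f u v \<longleftrightarrow> lincomb_defined f (replace_occs (subst_letter u v) l \<delta>)"

definition arg_deriv ::
    "'c letter \<Rightarrow> ('c, 'k::ring_1) series \<Rightarrow> ('c, 'k) series \<Rightarrow> ('c, 'k) series \<Rightarrow> ('c, 'k) series \<Rightarrow> ('c, 'k) series" where
  "arg_deriv l \<delta> f u v = lincomb f (replace_occs (subst_letter u v) l \<delta>)"


section \<open>Existence of the sums\<close>

lemma coeff_mult_nonzeroE:
  assumes "coeff (f * g) z \<noteq> 0"
  obtains p q where "z = p @ q" "coeff f p \<noteq> 0" "coeff g q \<noteq> 0"
proof -
  have "\<exists>s\<in>splits z. coeff f (fst s) * coeff g (snd s) \<noteq> 0"
    using assms sum.not_neutral_contains_not_neutral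
    by (fastforce simp: coeff_simps case_prod_unfold)
  then obtain s where "s \<in> splits z" "coeff f (fst s) \<noteq> 0" "coeff g (snd s) \<noteq> 0"
    by fastforce
  then show ?thesis using that[of "fst s" "snd s"] by (auto simp: splits_def)
qed

lemma coeff_single: "coeff (single c) w = (if w = [c] then 1 else 0)"
  by transfer simp

lemma coeff_word_nonzero: "coeff (prod_list (map single w)) z \<noteq> 0 \<Longrightarrow> z = w"
proof (induction w arbitrary: z)
  case (Cons c w)
  then show ?case
    by (auto simp: coeff_single elim!: coeff_mult_nonzeroE split: if_splits)
qed (simp add: coeff_simps split: if_splits)

lemma point_deriv_defined: "lincomb_defined f (replace_occs single l \<beta>)"
  unfolding lincomb_defined_def
proof
  fix z
  have "w \<in> (\<lambda>(i, j). take i z @ l # drop j z) ` ({..length z} \<times> {..length z})"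
    if "coeff f w * coeff (replace_occs single l \<beta> w) z \<noteq> 0" for w
  proof -
    have "(\<Sum>i | i < length w \<and> w ! i = l. coeff (prod_list ((map single w)[i := \<beta>])) z) \<noteq> 0"
      using that by (auto simp: replace_occs_def coeff_sum)
    then obtain i where i: "i < length w" "w ! i = l"
      and nz: "coeff (prod_list ((map single w)[i := \<beta>])) z \<noteq> 0"
      using sum.not_neutral_contains_not_neutral by force
    have "coeff (prod_list (map single (take i w)) * (\<beta> * prod_list (map single (drop (Suc i) w)))) z \<noteq> 0"
      using nz i(1) by (simp add: upd_conv_take_nth_drop take_map drop_map)
    then obtain q where z: "z = take i w @ q @ drop (Suc i) w"
      by (metis coeff_mult_nonzeroE coeff_word_nonzero)
    have "w = take i w @ l # drop (Suc i) w"
      using i id_take_nth_drop by blast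
    moreover have "take i z = take i w" "drop (i + length q) z = drop (Suc i) w"
      using i by (auto simp: z)
    ultimately have "w = (\<lambda>(i, j). take i z @ l # drop j z) (i, i + length q)"
      by simp
    moreover have "(i, i + length q) \<in> {..length z} \<times> {..length z}"
      using i by (auto simp: z)
    ultimately show ?thesis by blast
  qed
  then have "{w. coeff f w * coeff (replace_occs single l \<beta> w) z \<noteq> 0} \<subseteq>
      (\<lambda>(i, j). take i z @ l # drop j z) ` ({..length z} \<times> {..length z})"
    by blast
  then show "finite {w. coeff f w * coeff (replace_occs single l \<beta> w) z \<noteq> 0}"
    by (rule finite_subset) auto
qed

lemma subst_definedI:
  assumes "coeff u [] = 0" "coeff v [] = 0"
  shows "subst_defined f u v"
  unfolding subst_defined_def lincomb_defined_def
proof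
  fix z
  have *: "set w \<subseteq> insert X (insert Y (set z)) \<and> length w \<le> length z"
    if "coeff (subst_word u v w) z \<noteq> 0" for w
    using that
  proof (induction w arbitrary: z)
    case (Cons c w)
    from Cons.prems have "coeff (subst_letter u v c * subst_word u v w) z \<noteq> 0"
      by (simp add: subst_word_def)
    then obtain p q where z: "z = p @ q" and p: "coeff (subst_letter u v c) p \<noteq> 0"
      and q: "coeff (subst_word u v w) q \<noteq> 0"
      by (rule coeff_mult_nonzeroE)
    have "p \<noteq> [] \<and> c \<in> insert X (insert Y (set p))"
      using p assms by (cases c) (auto simp: coeff_single split: if_splits)
    then show ?case
      using Cons.IH[OF q] z by (cases p) auto
  qed simp
  have "{w. coeff f w * coeff (subst_word u v w) z \<noteq> 0} \<subseteq>
      {w. set w \<subseteq> insert X (insert Y (set z)) \<and> length w \<le> length z}"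
  proof clarify
    fix w assume "coeff f w * coeff (subst_word u v w) z \<noteq> 0"
    then have "coeff (subst_word u v w) z \<noteq> 0"
      by (metis mult_zero_right)
    then show "set w \<subseteq> insert X (insert Y (set z)) \<and> length w \<le> length z"
      by (rule * )
  qed
  then show "finite {w. coeff f w * coeff (subst_word u v w) z \<noteq> 0}"
    by (rule finite_subset) (simp add: finite_lists_length_le)
qed

end

theory Submission
  imports Defs
begin

text \<open>A point-derivative is a linear map each of whose output coefficients depends on only finitely
  many input coefficients. Such maps commute with infinite linear combinations, so the product rule,
  the chain rule and the commutator formula need only be checked on words, where the last one says
  that two derivations agree on letters.

  The delicate point is that the existence of \<open>f(u, v)\<close> implies the existence of both argument
  derivatives separately. If no letter of \<open>w\<close> is replaced by 0, then a lowest-degree word of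
  \<open>w(u, v)\<close> can be chosen that depends only on those letters of \<open>w\<close> that are replaced by series
  without constant term; so only finitely many words in the support of \<open>f\<close> share a given
  subword of such letters. A fixed coefficient of an argument derivative, in turn, involves only
  finitely many such subwords: all but one of these letters contribute degree at least 1, and the
  constants among them must occur in the given word.\<close>

section \<open>Continuous linear maps\<close>

text \<open>These are the functionals continuous for the product topology on series over discrete
  coefficients. The inductive form lets closure properties be proved by rule induction.\<close>

inductive finite_functional :: "(('a, 'k::comm_ring_1) ncfps \<Rightarrow> 'k) \<Rightarrow> bool" where
  coord: "finite_functional (\<lambda>f. coeff f w)"
| zero: "finite_functional (\<lambda>f. 0)"
| add: "finite_functional L \<Longrightarrow> finite_functional M \<Longrightarrow> finite_functional (\<lambda>f. L f + M f)"
| scale: "finite_functional L \<Longrightarrow> finite_functional (\<lambda>f. L f * c)"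

lemma finite_functional_diff:
  assumes "finite_functional L" "finite_functional M"
  shows "finite_functional (\<lambda>f. L f - M f)"
  using finite_functional.add[OF assms(1) finite_functional.scale[OF assms(2), of "-1"]] by simp

lemma finite_functional_sum:
  "(\<And>i. i \<in> I \<Longrightarrow> finite_functional (L i)) \<Longrightarrow> finite_functional (\<lambda>f. \<Sum>i\<in>I. L i f)"
  by (induction I rule: infinite_finite_induct)
     (auto intro: finite_functional.intros)

text \<open>Finiteness is carried through the induction along with the value: \<open>Sum_any\<close>
  is 0 on infinite supports, and its additivity needs finite ones.\<close>

lemma finite_functional_lincomb:
  assumes "finite_functional L" "lincomb_defined f A"
  shows "finite {w. coeff f w * L (A w) \<noteq> 0} \<and>
    L (lincomb f A) = Sum_any (\<lambda>w. coeff f w * L (A w))"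
  using assms(1)
proof induction
  case (coord z)
  then show ?case
    using assms(2) by (simp add: coeff_lincomb lincomb_defined_def)
next
  case (add L M)
  have "{w. coeff f w * (L (A w) + M (A w)) \<noteq> 0} \<subseteq>
      {w. coeff f w * L (A w) \<noteq> 0} \<union> {w. coeff f w * M (A w) \<noteq> 0}"
    by (auto simp: distrib_left)
  then show ?case
    using add.IH by (auto simp: distrib_left Sum_any.distrib intro: finite_subset)
next
  case (scale L c)
  have "{w. coeff f w * (L (A w) * c) \<noteq> 0} \<subseteq> {w. coeff f w * L (A w) \<noteq> 0}"
    by (auto simp flip: mult.assoc)
  then show ?case
    using scale.IH by (auto simp: Sum_any_left_distrib simp flip: mult.assoc intro: finite_subset)
qed simp

definition cont_linear :: "(('a, 'k::comm_ring_1) ncfps \<Rightarrow> ('a, 'k) ncfps) \<Rightarrow> bool" where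
  "cont_linear D \<longleftrightarrow> (\<forall>z. finite_functional (\<lambda>f. coeff (D f) z))"

lemma finite_functional_compose:
  assumes "finite_functional L" "cont_linear D"
  shows "finite_functional (\<lambda>f. L (D f))"
  using assms(1)
  by induction (use assms(2) in \<open>auto simp: cont_linear_def intro: finite_functional.intros\<close>)

lemma cont_linear_ident: "cont_linear (\<lambda>f. f)"
  by (simp add: cont_linear_def finite_functional.coord)

lemma cont_linear_compose:
  assumes "cont_linear D" "cont_linear E"
  shows "cont_linear (\<lambda>f. D (E f))"
  using finite_functional_compose[OF _ assms(2)] assms(1)
  unfolding cont_linear_def by blast

lemma cont_linear_add:
  "cont_linear D \<Longrightarrow> cont_linear E \<Longrightarrow> cont_linear (\<lambda>f. D f + E f)"
  by (simp add: cont_linear_def coeff_simps finite_functional.add)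

lemma cont_linear_diff:
  "cont_linear D \<Longrightarrow> cont_linear E \<Longrightarrow> cont_linear (\<lambda>f. D f - E f)"
  by (simp add: cont_linear_def coeff_simps finite_functional_diff)

lemma cont_linear_mult_right: "cont_linear D \<Longrightarrow> cont_linear (\<lambda>f. D f * g)"
  unfolding cont_linear_def coeff_simps case_prod_unfold
  by (auto intro!: finite_functional_sum finite_functional.scale)

lemma cont_linear_mult_left: "cont_linear D \<Longrightarrow> cont_linear (\<lambda>f. g * D f)"
  unfolding cont_linear_def coeff_simps case_prod_unfold
  \<comment> \<open>Puts the constant factor on the right, the shape of
    \<open>scale\<close>.\<close>
  by (subst mult.commute) (auto intro!: finite_functional_sum finite_functional.scale)

lemma cont_linear_additive:
  assumes "cont_linear D"
  shows "D (f + g) = D f + D g"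
proof (rule ncfps_eqI)
  have *: "L (f + g) = L f + L g" if "finite_functional L" for L
    using that by induction (simp_all add: coeff_simps distrib_right)
  show "coeff (D (f + g)) z = coeff (D f + D g) z" for z
    using assms by (simp add: cont_linear_def coeff_simps(3) *[of "\<lambda>f. coeff (D f) z"])
qed

lemma cont_linear_zero: "cont_linear D \<Longrightarrow> D 0 = 0"
  using cont_linear_additive[of D 0 0] by simp

lemma cont_linear_lincomb:
  assumes "cont_linear D" "lincomb_defined f A"
  shows "lincomb_defined f (\<lambda>w. D (A w))" "D (lincomb f A) = lincomb f (\<lambda>w. D (A w))"
proof -
  have ff: "finite_functional (\<lambda>f. coeff (D f) z)" for z
    using assms(1) by (simp add: cont_linear_def)
  note * = finite_functional_lincomb[OF ff assms(2)]
  show "lincomb_defined f (\<lambda>w. D (A w))"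
    using * by (simp add: lincomb_defined_def)
  show "D (lincomb f A) = lincomb f (\<lambda>w. D (A w))"
    by (rule ncfps_eqI) (use * in \<open>simp add: coeff_lincomb\<close>)
qed

lemma coeff_word:
  "coeff (prod_list (map single w)) z = (if z = w then 1 else (0 :: 'k::ring_1))"
proof (cases "z = w")
  case True
  have "coeff (prod_list (map single w)) w = (1 :: 'k)"
  proof (induction w)
    case (Cons c w)
    have "(\<Sum>(p, q)\<in>splits (c # w). coeff (single c) p * coeff (prod_list (map single w)) q :: 'k) =
        (\<Sum>(p, q)\<in>{([c], w)}. coeff (single c) p * coeff (prod_list (map single w)) q)"
      by (rule sum.mono_neutral_right[OF finite_splits])
         (auto simp: splits_def coeff_single split: if_splits)
    also have "\<dots> = 1"
      using Cons by (simp add: coeff_single)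
    finally show ?case
      by (simp only: list.map prod_list.Cons coeff_simps(6))
  qed (simp add: coeff_simps)
  then show ?thesis
    using True by simp
qed (use coeff_word_nonzero in auto)

lemma lincomb_words:
  fixes f :: "('a, 'k::comm_ring_1) ncfps"
  shows "lincomb_defined f (\<lambda>w. prod_list (map single w))"
    "lincomb f (\<lambda>w. prod_list (map single w)) = f"
proof -
  have supp: "{w. coeff f w * coeff (prod_list (map single w)) z \<noteq> 0} \<subseteq> {z}" for z
    by (auto simp: coeff_word split: if_splits)
  show "lincomb_defined f (\<lambda>w. prod_list (map single w))"
    using supp finite_subset by (fastforce simp: lincomb_defined_def)
  show "lincomb f (\<lambda>w. prod_list (map single w)) = f"
    by (rule ncfps_eqI)
       (simp only: coeff_lincomb Sum_any.expand_superset[OF _ supp] finite.intros, simp add: coeff_word)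
qed

text \<open>Every series is the pointwise finite combination of its words, and both maps can be
  moved inside that sum.\<close>

lemma cont_linear_eqI:
  assumes "cont_linear D" "cont_linear E"
    and "\<And>w. D (prod_list (map single w)) = E (prod_list (map single w))"
  shows "D f = E f"
  using cont_linear_lincomb(2)[OF assms(1) lincomb_words(1)[of f]]
    cont_linear_lincomb(2)[OF assms(2) lincomb_words(1)[of f]] assms(3)
  by (simp add: lincomb_words(2))


section \<open>Point-derivatives are continuous derivations\<close>

lemma replace_occs_Nil [simp]: "replace_occs \<phi> l \<delta> [] = 0"
  by (simp add: replace_occs_def)

lemma replace_occs_Cons:
  "replace_occs \<phi> l \<delta> (c # w) =
    (if c = l then \<delta> * prod_list (map \<phi> w) else 0) + \<phi> c * replace_occs \<phi> l \<delta> w"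
proof -
  have "{i. i < length (c # w) \<and> (c # w) ! i = l} =
      (if c = l then {0} else {}) \<union> Suc ` {i. i < length w \<and> w ! i = l}" (is "?I = ?A \<union> ?B")
    by (auto simp: image_iff less_Suc_eq_0_disj)
  moreover have "?A \<inter> ?B = {}" "finite ?A" "finite ?B"
    by auto
  ultimately have "replace_occs \<phi> l \<delta> (c # w) =
      (\<Sum>i\<in>?A. prod_list ((map \<phi> (c # w))[i := \<delta>])) + (\<Sum>i\<in>?B. prod_list ((map \<phi> (c # w))[i := \<delta>]))"
    unfolding replace_occs_def by (simp only: sum.union_disjoint)
  then show ?thesis
    by (simp add: replace_occs_def sum.reindex sum_distrib_left)
qed

text \<open>The product rule on words: an occurrence of \<open>l\<close> in \<open>w @ w'\<close>
  lies in exactly one of the two factors.\<close>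

lemma replace_occs_append:
  "replace_occs \<phi> l \<delta> (w @ w') =
    replace_occs \<phi> l \<delta> w * prod_list (map \<phi> w') + prod_list (map \<phi> w) * replace_occs \<phi> l \<delta> w'"
  by (induction w) (simp_all add: replace_occs_Cons algebra_simps)

lemma cont_linear_point_deriv:
  fixes \<beta> :: "('c, 'k::comm_ring_1) series"
  shows "cont_linear (point_deriv l \<beta>)"
  unfolding cont_linear_def
proof
  fix z
  let ?c = "\<lambda>w. coeff (replace_occs single l \<beta> w) z"
  define W where "W = {w. ?c w \<noteq> 0}"
  \<comment> \<open>The series with all coefficients 1 has every word in its support, so the
    existence of its derivative bounds the contributing words uniformly in \<open>f\<close>.\<close>
  have "finite W"
    using point_deriv_defined[of "Abs_ncfps (\<lambda>_. 1)" l \<beta>]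
    by (simp add: W_def lincomb_defined_def Abs_ncfps_inverse)
  have "{w. coeff f w * ?c w \<noteq> 0} \<subseteq> W" for f
    by (auto simp: W_def)
  then have "coeff (point_deriv l \<beta> f) z = (\<Sum>w\<in>W. coeff f w * ?c w)" for f
    using \<open>finite W\<close> by (simp add: point_deriv_def coeff_lincomb Sum_any.expand_superset)
  then show "finite_functional (\<lambda>f. coeff (point_deriv l \<beta> f) z)"
    by (auto intro!: finite_functional_sum finite_functional.intros)
qed

lemma point_deriv_word:
  fixes \<beta> :: "('c, 'k::comm_ring_1) series"
  shows "point_deriv l \<beta> (prod_list (map single w)) = replace_occs single l \<beta> w"
proof (rule ncfps_eqI)
  fix z
  let ?g = "\<lambda>w'. coeff (prod_list (map single w)) w' * coeff (replace_occs single l \<beta> w') z"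
  have "{w'. ?g w' \<noteq> 0} \<subseteq> {w}"
    by (auto simp: coeff_word split: if_splits)
  then have "Sum_any ?g = sum ?g {w}"
    by (intro Sum_any.expand_superset) auto
  then show "coeff (point_deriv l \<beta> (prod_list (map single w))) z = coeff (replace_occs single l \<beta> w) z"
    by (simp add: point_deriv_def coeff_lincomb coeff_word)
qed

lemma point_deriv_zero [simp]: "point_deriv l \<beta> (0 :: ('c, 'k::comm_ring_1) series) = 0"
  by (rule cont_linear_zero[OF cont_linear_point_deriv])

lemma point_deriv_one [simp]: "point_deriv l \<beta> (1 :: ('c, 'k::comm_ring_1) series) = 0"
  using point_deriv_word[of l \<beta> "[]"] by simp

lemma point_deriv_single [simp]:
  "point_deriv l \<beta> (single c :: ('c, 'k::comm_ring_1) series) = (if c = l then \<beta> else 0)"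
  using point_deriv_word[of l \<beta> "[c]"] by (simp add: replace_occs_Cons)

lemma point_deriv_add:
  "point_deriv l \<beta> (f + g :: ('c, 'k::comm_ring_1) series) = point_deriv l \<beta> f + point_deriv l \<beta> g"
  by (rule cont_linear_additive[OF cont_linear_point_deriv])

text \<open>Both sides are continuous and linear in \<open>f\<close> for fixed \<open>g\<close>, and
  in \<open>g\<close> for fixed \<open>f\<close>. Two reductions to words leave
  \<open>replace_occs_append\<close>.\<close>

lemma point_deriv_mult:
  fixes f g :: "('c, 'k::comm_ring_1) series"
  shows "point_deriv l \<beta> (f * g) = point_deriv l \<beta> f * g + f * point_deriv l \<beta> g"
proof (rule cont_linear_eqI[of "\<lambda>f. point_deriv l \<beta> (f * g)"
      "\<lambda>f. point_deriv l \<beta> f * g + f * point_deriv l \<beta> g"])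
  fix w :: "'c letter list"
  let ?m = "prod_list (map single w) :: ('c, 'k) series"
  show "point_deriv l \<beta> (?m * g) = point_deriv l \<beta> ?m * g + ?m * point_deriv l \<beta> g"
  proof (rule cont_linear_eqI[of "\<lambda>g. point_deriv l \<beta> (?m * g)"
        "\<lambda>g. point_deriv l \<beta> ?m * g + ?m * point_deriv l \<beta> g"])
    fix w' :: "'c letter list"
    show "point_deriv l \<beta> (?m * prod_list (map single w')) =
      point_deriv l \<beta> ?m * prod_list (map single w') + ?m * point_deriv l \<beta> (prod_list (map single w'))"
      using point_deriv_word[of l \<beta> "w @ w'"] by (simp add: point_deriv_word replace_occs_append)
  qed (intro cont_linear_add cont_linear_mult_left cont_linear_ident cont_linear_point_deriv
        cont_linear_compose[OF cont_linear_point_deriv])+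
qed (intro cont_linear_add cont_linear_mult_left cont_linear_mult_right cont_linear_ident
      cont_linear_point_deriv cont_linear_compose[OF cont_linear_point_deriv])+


section \<open>Existence of the argument derivatives\<close>

definition lowest_word :: "'a list \<Rightarrow> ('a, 'k::ring_1) ncfps \<Rightarrow> bool" where
  "lowest_word p f \<longleftrightarrow> coeff f p \<noteq> 0 \<and> (\<forall>q. coeff f q \<noteq> 0 \<longrightarrow> length p \<le> length q)"

lemma lowest_word_exists: "f \<noteq> 0 \<Longrightarrow> \<exists>p. lowest_word p f"
  unfolding lowest_word_def
  using ex_has_least_nat[of "\<lambda>p. coeff f p \<noteq> 0" _ length] ncfps_eqI[of f 0]
  by (auto simp: coeff_simps)

lemma lowest_word_Nil: "lowest_word p f \<Longrightarrow> coeff f [] \<noteq> 0 \<Longrightarrow> p = []"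
  by (force simp: lowest_word_def)

text \<open>If \<open>p @ q\<close> is split into support words of \<open>f\<close> and
  \<open>g\<close>, minimality forces their lengths, hence the same split. The coefficient there is
  a single product, nonzero in an integral domain.\<close>

lemma lowest_word_mult:
  fixes f g :: "('a, 'k::idom) ncfps"
  assumes f: "lowest_word p f" and g: "lowest_word q g"
  shows "lowest_word (p @ q) (f * g)"
proof -
  have "(\<Sum>(p', q')\<in>splits (p @ q). coeff f p' * coeff g q') = (\<Sum>(p', q')\<in>{(p, q)}. coeff f p' * coeff g q')"
  proof (rule sum.mono_neutral_right)
    show "\<forall>s\<in>splits (p @ q) - {(p, q)}. (case s of (p', q') \<Rightarrow> coeff f p' * coeff g q') = 0"
    proof (rule ballI, split prod.split, intro allI impI)
      fix s p' q' assume "s \<in> splits (p @ q) - {(p, q)}" "s = (p', q')"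
      then have s: "(p', q') \<noteq> (p, q)" and eq: "p' @ q' = p @ q"
        by (auto simp: splits_def)
      show "coeff f p' * coeff g q' = 0"
      proof (rule ccontr)
        assume "coeff f p' * coeff g q' \<noteq> 0"
        then have "length p \<le> length p'" "length q \<le> length q'"
          using f g by (auto simp: lowest_word_def)
        moreover have "length p' + length q' = length p + length q"
          using arg_cong[OF eq, of length] by simp
        ultimately show False
          using s eq by (simp add: append_eq_append_conv)
      qed
    qed
  qed (simp, simp add: splits_def)
  then have "coeff (f * g) (p @ q) \<noteq> 0"
    using f g by (simp add: coeff_simps lowest_word_def)
  moreover have "length (p @ q) \<le> length z" if "coeff (f * g) z \<noteq> 0" for z
    using that f g by (fastforce simp: lowest_word_def elim!: coeff_mult_nonzeroE intro: add_mono)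
  ultimately show ?thesis
    by (simp add: lowest_word_def)
qed

lemma lowest_word_prod_list:
  fixes \<phi> :: "'a \<Rightarrow> ('b, 'k::idom) ncfps"
  assumes "\<And>c. c \<in> set w \<Longrightarrow> lowest_word (low c) (\<phi> c)"
  shows "lowest_word (concat (map low w)) (prod_list (map \<phi> w))"
  using assms
proof (induction w)
  case Nil
  then show ?case by (simp add: lowest_word_def coeff_simps)
qed (simp add: lowest_word_mult)

text \<open>Over a field these are the letters replaced by noninvertible series. All constants are
  among them, since each is replaced by itself.\<close>

definition nonunit_letters :: "('c, 'k::ring_1) series \<Rightarrow> ('c, 'k) series \<Rightarrow> 'c letter list \<Rightarrow> 'c letter list" where
  "nonunit_letters u v = filter (\<lambda>c. coeff (subst_letter u v c) [] = 0)"

lemma subst_word_nonzeroD: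
  assumes "coeff (subst_word u v w) z \<noteq> 0"
  shows "(\<forall>c\<in>set w. subst_letter u v c \<noteq> 0) \<and> length (nonunit_letters u v w) \<le> length z \<and>
    set w \<subseteq> {X, Y} \<union> set z"
  using assms
proof (induction w arbitrary: z)
  case (Cons c w)
  from Cons.prems have "coeff (subst_letter u v c * subst_word u v w) z \<noteq> 0"
    by (simp add: subst_word_def)
  then obtain p q where z: "z = p @ q" and p: "coeff (subst_letter u v c) p \<noteq> 0"
    and q: "coeff (subst_word u v w) q \<noteq> 0"
    by (rule coeff_mult_nonzeroE)
  have "c \<in> {X, Y} \<union> set p"
    using p by (cases c) (auto simp: coeff_single split: if_splits)
  moreover have "subst_letter u v c \<noteq> 0"
    using p by (auto simp: coeff_simps)
  moreover have "p \<noteq> []" if "coeff (subst_letter u v c) [] = 0"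
    using p that by auto
  then have "length (nonunit_letters u v [c]) \<le> length p"
    by (cases p) (auto simp: nonunit_letters_def)
  ultimately show ?case
    using Cons.IH[OF q] z by (auto simp: nonunit_letters_def split: if_splits)
qed (simp add: nonunit_letters_def)

text \<open>Every nonunit letter left in place contributes at least one letter to \<open>z\<close>,
  and a constant contributes itself. The replaced occurrence may contribute the empty word, hence
  \<open>Suc\<close>. The condition on \<open>\<delta>\<close> ensures that \<open>l\<close> too has
  a nonzero substitute.\<close>

lemma replace_occs_nonzeroD:
  assumes "coeff (replace_occs (subst_letter u v) l \<delta> w) z \<noteq> 0"
    and "l \<in> {X, Y}" and "subst_letter u v l = 0 \<Longrightarrow> \<delta> = 0"
  shows "(\<forall>c\<in>set w. subst_letter u v c \<noteq> 0) \<and> length (nonunit_letters u v w) \<le> Suc (length z) \<and>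
    set w \<subseteq> {X, Y} \<union> set z"
  using assms(1)
proof (induction w arbitrary: z)
  case (Cons c w)
  from Cons.prems consider
      "c = l" "coeff (\<delta> * subst_word u v w) z \<noteq> 0"
    | "coeff (subst_word u v [c] * replace_occs (subst_letter u v) l \<delta> w) z \<noteq> 0"
    by (force simp: replace_occs_Cons subst_word_def coeff_simps(1,3) split: if_splits)
  then show ?case
  proof cases
    case 1
    from 1(2) obtain p q where z: "z = p @ q" and p: "coeff \<delta> p \<noteq> 0"
      and q: "coeff (subst_word u v w) q \<noteq> 0"
      by (rule coeff_mult_nonzeroE)
    have "subst_letter u v l \<noteq> 0"
      using p assms(3) by (auto simp: coeff_simps)
    then show ?thesis
      using subst_word_nonzeroD[OF q] 1(1) assms(2) z by (auto simp: nonunit_letters_def)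
  next
    case 2
    then obtain p q where z: "z = p @ q" and p: "coeff (subst_word u v [c]) p \<noteq> 0"
      and q: "coeff (replace_occs (subst_letter u v) l \<delta> w) q \<noteq> 0"
      by (rule coeff_mult_nonzeroE)
    show ?thesis
      using subst_word_nonzeroD[OF p] Cons.IH[OF q] z
      by (auto simp: nonunit_letters_def split: if_splits)
  qed
qed (simp add: coeff_simps)

text \<open>The contributing words with nonunit letters \<open>s\<close> all lie in the finite set
  \<open>?F s\<close>, and \<open>s\<close> ranges over the finite set \<open>S\<close>. The
  condition on \<open>\<delta>\<close> matters: for \<open>u = 0\<close>, \<open>v = 1\<close> and
  \<open>f\<close> the sum of all \<open>x y^n\<close>, every word of \<open>f(u, v)\<close>
  vanishes, but the derivative in the first argument would add up infinitely many copies of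
  \<open>\<delta>\<close>.\<close>

lemma arg_deriv_definedI:
  fixes f :: "('c, 'k::idom) series"
  assumes f: "subst_defined f u v"
    and l: "l \<in> {X, Y}" "subst_letter u v l = 0 \<Longrightarrow> \<delta> = 0"
  shows "arg_deriv_defined l \<delta> f u v"
  unfolding arg_deriv_defined_def lincomb_defined_def
proof
  fix z :: "'c letter list"
  have "\<forall>c. \<exists>p. subst_letter u v c \<noteq> 0 \<longrightarrow> lowest_word p (subst_letter u v c)"
    using lowest_word_exists by blast
  \<comment> \<open>One lowest word per letter is fixed before \<open>w\<close>, so words with the
    same nonunit letters share one concatenation.\<close>
  then obtain low where
    low: "subst_letter u v c \<noteq> 0 \<Longrightarrow> lowest_word (low c) (subst_letter u v c)" for c
    by metis
  define S where "S = {s. set s \<subseteq> {X, Y} \<union> set z \<and> length s \<le> Suc (length z)}"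
  have "finite S"
    unfolding S_def by (rule finite_lists_length_le) simp
  let ?F = "\<lambda>s. {w. coeff f w * coeff (subst_word u v w) (concat (map low s)) \<noteq> 0}"
  have "{w. coeff f w * coeff (replace_occs (subst_letter u v) l \<delta> w) z \<noteq> 0} \<subseteq> (\<Union>s\<in>S. ?F s)"
  proof clarify
    fix w assume "coeff f w * coeff (replace_occs (subst_letter u v) l \<delta> w) z \<noteq> 0"
    then have fw: "coeff f w \<noteq> 0" and w: "coeff (replace_occs (subst_letter u v) l \<delta> w) z \<noteq> 0"
      by auto
    note * = replace_occs_nonzeroD[OF w l]
    have lw: "lowest_word (low c) (subst_letter u v c)" if "c \<in> set w" for c
      using * low that by blast
    \<comment> \<open>The other letters of \<open>w\<close> have substitutes with nonzero constant
      term, so their lowest word is empty.\<close>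
    have "concat (map low w) = concat (map low (nonunit_letters u v w))"
      using lw by (induction w) (auto simp: nonunit_letters_def dest: lowest_word_Nil)
    then have "coeff (subst_word u v w) (concat (map low (nonunit_letters u v w))) \<noteq> 0"
      using lowest_word_prod_list[of w low "subst_letter u v", OF lw] by (simp add: lowest_word_def subst_word_def)
    moreover have "nonunit_letters u v w \<in> S"
      using * by (auto simp: S_def nonunit_letters_def)
    ultimately show "w \<in> (\<Union>s\<in>S. ?F s)"
      using fw by auto
  qed
  moreover have "finite (\<Union>s\<in>S. ?F s)"
    using \<open>finite S\<close> f by (simp add: subst_defined_def lincomb_defined_def)
  ultimately show "finite {w. coeff f w * coeff (replace_occs (subst_letter u v) l \<delta> w) z \<noteq> 0}"
    by (rule finite_subset)
qed


section \<open>Chain rule and commutator\<close>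

lemma lincomb_add:
  assumes "lincomb_defined f A" "lincomb_defined f B"
  shows "lincomb f (\<lambda>w. A w + B w) = lincomb f A + lincomb f B"
  by (rule ncfps_eqI)
     (use assms in \<open>simp add: coeff_lincomb coeff_simps(3) distrib_left Sum_any.distrib lincomb_defined_def\<close>)

text \<open>The product rule differentiates one factor at a time: occurrences of \<open>X\<close>
  give the first sum, those of \<open>Y\<close> the second, constants nothing.\<close>

lemma point_deriv_subst_word:
  fixes u v :: "('c, 'k::comm_ring_1) series"
  shows "point_deriv X \<beta> (subst_word u v w) =
    replace_occs (subst_letter u v) X (point_deriv X \<beta> u) w +
    replace_occs (subst_letter u v) Y (point_deriv X \<beta> v) w"
proof (induction w)
  case (Cons c w)
  then show ?case
    by (cases c) (simp_all add: subst_word_def point_deriv_mult replace_occs_Cons algebra_simps)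
qed (simp add: subst_word_def)

text \<open>The derivative moves inside the sum for \<open>f(u, v)\<close>, where the chain rule for
  words applies. Splitting the result needs both sums to exist separately; a zero substitute has
  zero derivative, as \<open>arg_deriv_definedI\<close> demands.\<close>

lemma point_deriv_subst:
  fixes f u v \<beta> :: "('c, 'k::idom) series"
  assumes "subst_defined f u v"
  shows "arg_deriv_defined X (point_deriv X \<beta> u) f u v"
    and "arg_deriv_defined Y (point_deriv X \<beta> v) f u v"
    and "point_deriv X \<beta> (subst f u v) =
      arg_deriv X (point_deriv X \<beta> u) f u v + arg_deriv Y (point_deriv X \<beta> v) f u v"
proof -
  show X: "arg_deriv_defined X (point_deriv X \<beta> u) f u v"
    and Y: "arg_deriv_defined Y (point_deriv X \<beta> v) f u v"
    by (auto intro!: arg_deriv_definedI[OF assms])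
  show "point_deriv X \<beta> (subst f u v) =
      arg_deriv X (point_deriv X \<beta> u) f u v + arg_deriv Y (point_deriv X \<beta> v) f u v"
    using cont_linear_lincomb(2)[OF cont_linear_point_deriv, of f "subst_word u v" X \<beta>] assms
      lincomb_add[OF X[unfolded arg_deriv_defined_def] Y[unfolded arg_deriv_defined_def]]
    by (simp add: subst_defined_def subst_def arg_deriv_def point_deriv_subst_word)
qed

lemma point_deriv_commutator:
  fixes f \<beta> \<gamma> :: "('c, 'k::comm_ring_1) series"
  shows "point_deriv Y \<gamma> (point_deriv X \<beta> f) - point_deriv X \<beta> (point_deriv Y \<gamma> f) =
    point_deriv X (point_deriv Y \<gamma> \<beta>) f - point_deriv Y (point_deriv X \<beta> \<gamma>) f"
    (is "?D f = ?E f")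
proof (rule cont_linear_eqI[of ?D ?E])
  \<comment> \<open>The mixed terms, with one derivative on each factor, are the same in both orders
    and cancel.\<close>
  have D_mult: "?D (g * h) = ?D g * h + g * ?D h" for g h
    by (simp add: point_deriv_mult point_deriv_add algebra_simps)
  have E_mult: "?E (g * h) = ?E g * h + g * ?E h" for g h
    by (simp add: point_deriv_mult algebra_simps)
  \<comment> \<open>Both sides give the derivative of \<open>\<beta>\<close> at \<open>X\<close>,
    minus the derivative of \<open>\<gamma>\<close> at \<open>Y\<close>, and 0 at constants.\<close>
  have letter: "?D (single c) = ?E (single c)" for c
    by (cases c) simp_all
  show "?D (prod_list (map single w)) = ?E (prod_list (map single w))" for w
  proof (induction w)
    case (Cons c w)
    then show ?case
      by (simp only: list.map prod_list.Cons D_mult E_mult letter)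
  qed simp
qed (intro cont_linear_diff cont_linear_point_deriv cont_linear_compose[OF cont_linear_point_deriv])+

text \<open>Existence of both argument derivatives belongs to the conclusion because
  \<open>lincomb\<close> gives undefined sums dummy values. Constant terms in \<open>u\<close> and
  \<open>v\<close> are allowed as long as \<open>f(u, v)\<close> exists.\<close>

theorem proposition2p1:
  fixes f \<beta> \<gamma> u v :: "('c::infinite, 'k::field_char_0) series"
  shows "(subst_defined f u v \<longrightarrow>
      arg_deriv_defined X (point_deriv X \<beta> u) f u v \<and>
      arg_deriv_defined Y (point_deriv X \<beta> v) f u v \<and>
      point_deriv X \<beta> (subst f u v) =
        arg_deriv X (point_deriv X \<beta> u) f u v + arg_deriv Y (point_deriv X \<beta> v) f u v) \<and>
    point_deriv Y \<gamma> (point_deriv X \<beta> f) - point_deriv X \<beta> (point_deriv Y \<gamma> f) =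
      point_deriv X (point_deriv Y \<gamma> \<beta>) f - point_deriv Y (point_deriv X \<beta> \<gamma>) f"
  using point_deriv_subst point_deriv_commutator by blast

end
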